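(* Let $G=K_n$ and let $J$ be the matching with edge set $\{(i,i') : 1\le i\le n\}$. Then $\Phi(G^k)\ge \frac{n}{2}$ for all $k\ge 1$.
   Context: Let $G=K_n$ with vertex set $\{v_1,\dots,v_n\}$, and $K_{n,n}$ the complete bipartite graph with parts $\{1,\dots,n\}$ and $\{1',\dots,n'\}$. The self-similar graphs based on $(G,J)$: $G^1=G$; for $k\ge2$, $V(G^k)=V(G)^k$, and $(v_{i_1},\dots,v_{i_k})\sim(v_{j_1},\dots,v_{j_k})$ in $G^k$ iff either (1) $(v_{i_1},\dots,v_{i_{k-1}})=(v_{j_1},\dots,v_{j_{k-1}})$ and $v_{i_k}\sim v_{j_k}$ in $G$, or (2) $(v_{i_1},\dots,v_{i_{k-1}})\sim(v_{j_1},\dots,v_{j_{k-1}})$ in $G^{k-1}$ and $i_k\sim j_k'$ in $J$. The conductance (edge expansion coefficient) of a graph $H$ is $\Phi(H)=\min \frac{\delta_H(S)}{|S|}$ over all non-empty $S\subseteq V(H)$ with $|S|\le |V(H)|/2$, where $\delta_H(S)$ is the number of edges joining $S$ to $V(H)\setminus S$. *)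

theory Defs
  imports Complex_Main "Graph_Theory.Graph_Theory"
begin

text \<open>
  As in the Graph Theory library, an undirected graph is a symmetric digraph: an edge
  between \<open>x\<close> and \<open>y\<close> is the pair of arcs \<open>(x, y)\<close> and \<open>(y, x)\<close>.  Hence each edge joining
  \<open>S\<close> to its complement has exactly one of its two arcs leaving \<open>S\<close>, and counting the
  leaving arcs counts the edges.
\<close>

definition edge_boundary :: "('a, 'b) pre_digraph \<Rightarrow> 'a set \<Rightarrow> 'b set" where
  "edge_boundary H S = {e \<in> arcs H. tail H e \<in> S \<and> head H e \<in> verts H - S}"

text \<open>
  A minimum over a finite set of sets \<open>S\<close>, meaningful only if \<open>H\<close> is finite with at least
  two vertices (otherwise no \<open>S\<close> is admissible).
\<close>

definition conductance :: "('a, 'b) pre_digraph \<Rightarrow> real" where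
  "conductance H = Min {real (card (edge_boundary H S)) / real (card S) | S.
     S \<subseteq> verts H \<and> S \<noteq> {} \<and> real (card S) \<le> real (card (verts H)) / 2}"

text \<open>
  The parameters are \<open>n\<close>, a labelling \<open>v\<^sub>1, \<dots>, v\<^sub>n\<close> of the vertices of \<open>G\<close> (a function on
  \<open>{1..n}\<close>), the graph \<open>G\<close>, and a subgraph \<open>J\<close> of the complete bipartite graph with
  parts \<open>{1, \<dots>, n}\<close> and \<open>{1', \<dots>, n'}\<close>; there \<open>i\<close> is represented by \<open>Inl i\<close> and
  \<open>i'\<close> by \<open>Inr i\<close>.  A \<open>k\<close>-tuple is a list of length \<open>k\<close>, its last coordinate being at the
  end of the list.  The value at exponent \<open>0\<close> is a convention that is never used.
\<close>

fun self_similar :: "nat \<Rightarrow> (nat \<Rightarrow> 'a) \<Rightarrow> 'a pair_pre_digraph \<Rightarrow> (nat + nat) pair_pre_digraph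
    \<Rightarrow> nat \<Rightarrow> 'a list pair_pre_digraph" where
  "self_similar n v G J 0 = \<lparr> pverts = {[]}, parcs = {} \<rparr>"
| "self_similar n v G J (Suc 0) =
    \<lparr> pverts = {[x] | x. x \<in> pverts G}, parcs = {([x], [y]) | x y. (x, y) \<in> parcs G} \<rparr>"
| "self_similar n v G J (Suc (Suc k)) =
    (let H = self_similar n v G J (Suc k) in
     \<lparr> pverts = {xs @ [x] | xs x. xs \<in> pverts H \<and> x \<in> pverts G},
       parcs = {(xs @ [v i], ys @ [v j]) | xs ys i j.
         xs \<in> pverts H \<and> ys \<in> pverts H \<and> i \<in> {1..n} \<and> j \<in> {1..n} \<and>
         (xs = ys \<and> (v i, v j) \<in> parcs G \<or>
          (xs, ys) \<in> parcs H \<and> (Inl i, Inr j) \<in> parcs J)} \<rparr>)"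

definition identity_matching :: "nat \<Rightarrow> (nat + nat) pair_pre_digraph" where
  "identity_matching n = \<lparr> pverts = {1..n} <+> {1..n},
     parcs = {(Inl i, Inr i) | i. i \<in> {1..n}} \<union> {(Inr i, Inl i) | i. i \<in> {1..n}} \<rparr>"

lemma pverts_self_similar:
  assumes "k \<ge> 1"
  shows "pverts (self_similar n v G J k) = {xs. set xs \<subseteq> pverts G \<and> length xs = k}"
  using assms
proof (induction n v G J k rule: self_similar.induct)
  case (2 n v G J)
  then show ?case by (auto simp: length_Suc_conv)
next
  case (3 n v G J k)
  then have "pverts (self_similar n v G J (Suc (Suc k))) =
      {xs @ [x] | xs x. (set xs \<subseteq> pverts G \<and> length xs = Suc k) \<and> x \<in> pverts G}"
    by (simp add: Let_def)
  also have "\<dots> = {xs. set xs \<subseteq> pverts G \<and> length xs = Suc (Suc k)}"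
  proof (intro set_eqI iffI)
    fix ys assume "ys \<in> {xs. set xs \<subseteq> pverts G \<and> length xs = Suc (Suc k)}"
    then show "ys \<in> {xs @ [x] | xs x.
        (set xs \<subseteq> pverts G \<and> length xs = Suc k) \<and> x \<in> pverts G}"
      by (cases ys rule: rev_cases) auto
  qed auto
  finally show ?case .
qed simp

lemma sym_self_similar:
  assumes "sym (parcs G)"
  shows "sym (parcs (self_similar n v G (identity_matching n) k))"
proof (induction k)
  case (Suc k)
  have J: "(Inl i, Inr j) \<in> parcs (identity_matching n) \<longleftrightarrow> i = j \<and> i \<in> {1..n}" for i j
    by (auto simp: identity_matching_def)
  show ?case
  proof (cases k)
    case 0
    then show ?thesis using assms by (auto simp: sym_def)
  next
    case (Suc m)
    show ?thesis
      unfolding Suc self_similar.simps Let_def J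
      using assms Suc.IH[unfolded Suc] by (simp add: sym_def) blast
  qed
qed (simp add: sym_def)

end

theory Submission
  imports Defs
begin

text \<open>
  With \<open>J\<close> the identity matching, \<open>G\<^sup>k\<close> is a Cartesian power of \<open>K\<^sub>n\<close>.  Join every
  pair \<open>(u, w) \<in> S \<times> (V - S)\<close> by the canonical path that replaces the coordinates of \<open>u\<close> by
  those of \<open>w\<close> one at a time.  It contains an arc leaving \<open>S\<close>, and each arc lies on at most
  \<open>n\<^bsup>k-1\<^esup>\<close> of these paths, so
  \<open>\<bar>S\<bar> * \<bar>V - S\<bar> \<le> n\<^bsup>k-1\<^esup> * \<delta>(S)\<close>.  If \<open>\<bar>S\<bar> \<le> n\<^sup>k / 2\<close>, then \<open>\<bar>V - S\<bar> \<ge> n\<^sup>k / 2\<close>, and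
  dividing yields the bound.
\<close>

text \<open>The product counts the ordered pairs separated by the cut. Since neither side of the cut
  has to be small or nonempty, the bound applies to every slice of a cut in a product, whatever the
  size of the slice; this is what makes it fit for induction.\<close>

definition cut_bound :: "'a set \<Rightarrow> ('a \<times> 'a) set \<Rightarrow> nat \<Rightarrow> bool" where
  "cut_bound V E c \<longleftrightarrow> (\<forall>S \<subseteq> V. card S * card (V - S) \<le> c * card (E \<inter> S \<times> (V - S)))"

lemma cut_boundD:
  "cut_bound V E c \<Longrightarrow> S \<subseteq> V \<Longrightarrow> card S * card (V - S) \<le> c * card (E \<inter> S \<times> (V - S))"
  by (simp add: cut_bound_def)

lemma cut_bound_complete: "cut_bound V {(x, y). x \<in> V \<and> y \<in> V \<and> x \<noteq> y} 1"
proof -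
  have "{(x, y). x \<in> V \<and> y \<in> V \<and> x \<noteq> y} \<inter> S \<times> (V - S) = S \<times> (V - S)" if "S \<subseteq> V" for S
    using that by auto
  then show ?thesis
    by (simp add: cut_bound_def card_cartesian_product)
qed

text \<open>A relabelling of vertices preserves cuts and their arcs. It serves to pass from pairs
  \<open>(xs, x)\<close> to lists \<open>xs @ [x]\<close>. Arcs are restricted to
  \<open>V \<times> V\<close> because \<open>f\<close> is injective only there.\<close>

lemma cut_bound_inj_image:
  assumes "cut_bound V E c" "inj_on f V"
  shows "cut_bound (f ` V) (map_prod f f ` (E \<inter> V \<times> V)) c"
  unfolding cut_bound_def
proof (intro allI impI)
  fix S assume "S \<subseteq> f ` V"
  then obtain T where T: "T \<subseteq> V" "S = f ` T"
    by (meson subset_imageE)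
  have diff: "f ` V - S = f ` (V - T)"
    using T assms(2) by (simp add: inj_on_image_set_diff)
  have inj: "inj_on (map_prod f f) (V \<times> V)"
    using map_prod_inj_on[OF assms(2) assms(2)] .
  have "map_prod f f ` (E \<inter> V \<times> V) \<inter> S \<times> (f ` V - S)
      = map_prod f f ` (E \<inter> V \<times> V) \<inter> map_prod f f ` (T \<times> (V - T))"
    using T(2) diff by (simp add: map_prod_surj_on)
  also have "\<dots> = map_prod f f ` ((E \<inter> V \<times> V) \<inter> T \<times> (V - T))"
    by (rule inj_on_image_Int[OF inj, symmetric]) (use T in auto)
  also have "(E \<inter> V \<times> V) \<inter> T \<times> (V - T) = E \<inter> T \<times> (V - T)"
    using T by auto
  finally have "card (map_prod f f ` (E \<inter> V \<times> V) \<inter> S \<times> (f ` V - S)) = card (E \<inter> T \<times> (V - T))"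
    using T by (simp add: card_image inj_on_subset[OF inj] Sigma_mono Int_lower2 le_infI2)
  moreover have "card S = card T" "card (f ` V - S) = card (V - T)"
    using T diff assms(2) by (auto simp: card_image inj_on_subset)
  ultimately show "card S * card (f ` V - S)
      \<le> c * card (map_prod f f ` (E \<inter> V \<times> V) \<inter> S \<times> (f ` V - S))"
    using cut_boundD[OF assms(1) T(1)] by simp
qed

text \<open>The route from \<open>(a, x)\<close> to \<open>(b, y)\<close> goes through
  \<open>(b, x)\<close>. Its first leg is shared by the \<open>card V\<close> choices of
  \<open>y\<close>, its second by the \<open>card W\<close> choices of \<open>a\<close>. Bounding
  the crossing legs slice by slice with the factor bounds gives the two products that
  \<open>c\<close> has to dominate.\<close>

lemma cut_bound_cartesian_product:
  assumes fin: "finite V" "finite W"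
    and V: "cut_bound V D c\<^sub>1" and W: "cut_bound W E c\<^sub>2"
    and c: "card W * c\<^sub>1 \<le> c" "card V * c\<^sub>2 \<le> c"
  shows "cut_bound (W \<times> V) {((a, x), (b, y)). a \<in> W \<and> b \<in> W \<and> x \<in> V \<and> y \<in> V \<and>
    (a = b \<and> (x, y) \<in> D \<or> (a, b) \<in> E \<and> x = y)} c" (is "cut_bound _ ?F c")
  unfolding cut_bound_def
proof (intro allI impI)
  fix S assume S: "S \<subseteq> W \<times> V"
  let ?V = "\<lambda>a. {x \<in> V. (a, x) \<in> S}" and ?W = "\<lambda>x. {a \<in> W. (a, x) \<in> S}"
  let ?cV = "\<lambda>a. ?V a \<times> (V - ?V a)" and ?cW = "\<lambda>x. ?W x \<times> (W - ?W x)"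
  \<comment> \<open>Each of \<open>?P\<close> and \<open>?Q\<close> records a leg crossing the cut
    inside one slice, followed by the one coordinate that the leg leaves free; \<open>?p\<close> and
    \<open>?q\<close> recover the pair of endpoints.\<close>
  let ?P = "(SIGMA x:V. ?cW x) \<times> V" and ?Q = "(SIGMA b:W. ?cV b) \<times> W"
  let ?p = "\<lambda>((x, a, b), y). ((a, x), (b, y))" and ?q = "\<lambda>((b, x, y), a). ((a, x), (b, y))"
  let ?M = "SIGMA b:W. D \<inter> ?cV b" and ?N = "SIGMA x:V. E \<inter> ?cW x"
  have finS: "finite S"
    using S fin finite_subset by blast
  txt \<open>A pair \<open>((a, x), (b, y))\<close> of the cut is charged to \<open>a, b\<close> or to \<open>x, y\<close>
    according to the side on which the intermediate vertex \<open>(b, x)\<close> lies.\<close>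
  have "S \<times> (W \<times> V - S) \<subseteq> ?p ` ?P \<union> ?q ` ?Q"
  proof
    fix z assume z: "z \<in> S \<times> (W \<times> V - S)"
    obtain a x b y where [simp]: "z = ((a, x), (b, y))"
      by (metis prod.exhaust)
    show "z \<in> ?p ` ?P \<union> ?q ` ?Q"
    proof (cases "(b, x) \<in> S")
      case True
      then have "((b, x, y), a) \<in> ?Q" using z S by auto
      then have "z \<in> ?q ` ?Q" by (rule rev_image_eqI) simp
      then show ?thesis ..
    next
      case False
      then have "((x, a, b), y) \<in> ?P" using z S by auto
      then have "z \<in> ?p ` ?P" by (rule rev_image_eqI) simp
      then show ?thesis ..
    qed
  qed
  moreover have finPQ: "finite ?P" "finite ?Q"
    using fin by (auto intro!: finite_SigmaI)
  ultimately have "card (S \<times> (W \<times> V - S)) \<le> card (?p ` ?P \<union> ?q ` ?Q)"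
    by (intro card_mono) auto
  also have "\<dots> \<le> card ?P + card ?Q"
    using card_Un_le[of "?p ` ?P" "?q ` ?Q"] card_image_le[OF finPQ(1), of ?p]
      card_image_le[OF finPQ(2), of ?q] by linarith
  also have "card ?P = card V * (\<Sum>x\<in>V. card (?W x) * card (W - ?W x))"
    using fin by (simp add: card_cartesian_product mult.commute)
  \<comment> \<open>The bound for \<open>W\<close> is applied in each slice \<open>x\<close> to the
    set \<open>?W x\<close>.\<close>
  also have "\<dots> \<le> card V * (\<Sum>x\<in>V. c\<^sub>2 * card (E \<inter> ?cW x))"
    by (intro mult_left_mono sum_mono cut_boundD[OF W]) auto
  also have "\<dots> = card V * c\<^sub>2 * card ?N"
    using fin by (simp add: sum_distrib_left mult.assoc)
  also have "card ?Q = card W * (\<Sum>b\<in>W. card (?V b) * card (V - ?V b))"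
    using fin by (simp add: card_cartesian_product mult.commute)
  also have "\<dots> \<le> card W * (\<Sum>b\<in>W. c\<^sub>1 * card (D \<inter> ?cV b))"
    by (intro mult_left_mono sum_mono cut_boundD[OF V]) auto
  also have "\<dots> = card W * c\<^sub>1 * card ?M"
    using fin by (simp add: sum_distrib_left mult.assoc)
  also have "card V * c\<^sub>2 * card ?N + card W * c\<^sub>1 * card ?M \<le> c * (card ?N + card ?M)"
    unfolding distrib_left by (intro add_mono mult_right_mono c) auto
  also have "card ?N + card ?M \<le> card (?F \<inter> S \<times> (W \<times> V - S))"
  proof -
    let ?f = "\<lambda>(x, a, b). ((a, x), (b, x))" and ?g = "\<lambda>(b, x, y). ((b, x), (b, y))"
    have finNM: "finite ?N" "finite ?M"
      using fin by (auto intro!: finite_SigmaI)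
    have "card ?N + card ?M = card (?f ` ?N) + card (?g ` ?M)"
      by (intro arg_cong2[where f = "(+)"] card_image[symmetric] inj_onI) auto
    \<comment> \<open>No arc is counted twice: arcs from \<open>?N\<close> cross the cut within a
      slice of fixed \<open>x\<close>, so their first coordinates differ, whereas arcs from
      \<open>?M\<close> keep the first coordinate.\<close>
    also have "\<dots> = card (?f ` ?N \<union> ?g ` ?M)"
      by (rule card_Un_disjoint[symmetric]) (use finNM in auto)
    also have "\<dots> \<le> card (?F \<inter> S \<times> (W \<times> V - S))"
      using finS fin by (intro card_mono) auto
    finally show ?thesis .
  qed
  finally show "card S * card (W \<times> V - S) \<le> c * card (?F \<inter> S \<times> (W \<times> V - S))"
    by (simp add: card_cartesian_product)
qed

lemma cut_bound_self_similar:
  assumes G: "K\<^bsub>n\<^esub> (with_proj G)" and v: "bij_betw v {1..n} (pverts G)"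
  shows "cut_bound (pverts (self_similar n v G (identity_matching n) (Suc m)))
    (parcs (self_similar n v G (identity_matching n) (Suc m))) (n ^ m)"
proof -
  have cV: "cut_bound (pverts G) (parcs G) 1"
    using G cut_bound_complete[of "pverts G"] by (simp add: complete_digraph_pair_def)
  have GV: "parcs G \<subseteq> pverts G \<times> pverts G"
    using G by (auto simp: complete_digraph_pair_def)
  have fin: "finite (pverts G)" and card: "card (pverts G) = n"
    using v bij_betw_finite[OF v] bij_betw_same_card[OF v] by auto
  show ?thesis
  proof (induction m)
    case 0
    have "inj_on (\<lambda>x. [x]) (pverts G)" by (simp add: inj_on_def)
    from cut_bound_inj_image[OF cV this]
    have "cut_bound ((\<lambda>x. [x]) ` pverts G) (map_prod (\<lambda>x. [x]) (\<lambda>x. [x]) ` parcs G) 1"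
      using GV by (simp add: Int_absorb2)
    moreover have "(\<lambda>x. [x]) ` pverts G = {[x] | x. x \<in> pverts G}"
      by auto
    moreover have "map_prod (\<lambda>x. [x]) (\<lambda>x. [x]) ` parcs G = {([x], [y]) | x y. (x, y) \<in> parcs G}"
      by force
    ultimately show ?case by simp
  next
    case (Suc m)
    let ?H = "self_similar n v G (identity_matching n) (Suc m)"
    let ?H' = "self_similar n v G (identity_matching n) (Suc (Suc m))"
    let ?f = "\<lambda>(xs, x). xs @ [x]"
    let ?F = "{((a, x), (b, y)). a \<in> pverts ?H \<and> b \<in> pverts ?H \<and> x \<in> pverts G \<and> y \<in> pverts G \<and>
      (a = b \<and> (x, y) \<in> parcs G \<or> (a, b) \<in> parcs ?H \<and> x = y)}"
    have verts: "pverts ?H = {xs. set xs \<subseteq> pverts G \<and> length xs = Suc m}"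
      by (rule pverts_self_similar) simp
    have finH: "finite (pverts ?H)" and cardH: "card (pverts ?H) = n ^ Suc m"
      unfolding verts using fin card
      by (simp_all only: finite_lists_length_eq card_lists_length_eq)
    \<comment> \<open>Both constants come out equal: \<open>n ^ Suc m * 1\<close> from the new
      factor \<open>G\<close> and \<open>n * n ^ m\<close> from the induction hypothesis.\<close>
    have "cut_bound (pverts ?H \<times> pverts G) ?F (n ^ Suc m)"
      by (rule cut_bound_cartesian_product[OF fin finH cV Suc.IH])
        (simp_all only: card cardH mult_1_right power_Suc order_refl)
    moreover have "inj_on ?f (pverts ?H \<times> pverts G)"
      by (auto simp: inj_on_def)
    ultimately have "cut_bound (?f ` (pverts ?H \<times> pverts G))
        (map_prod ?f ?f ` (?F \<inter> (pverts ?H \<times> pverts G) \<times> pverts ?H \<times> pverts G)) (n ^ Suc m)"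
      by (rule cut_bound_inj_image)
    moreover have "?f ` (pverts ?H \<times> pverts G) = pverts ?H'"
      by (auto simp: Let_def simp del: self_similar.simps(2))
    moreover have "map_prod ?f ?f ` (?F \<inter> (pverts ?H \<times> pverts G) \<times> pverts ?H \<times> pverts G)
        = parcs ?H'"
    proof -
      have J: "(Inl i, Inr j) \<in> parcs (identity_matching n) \<longleftrightarrow> i = j \<and> i \<in> {1..n}" for i j
        by (auto simp: identity_matching_def)
      have im: "pverts G = v ` {1..n}"
        using v by (simp add: bij_betw_def)
      have inj: "inj_on v {1..n}"
        using v by (simp add: bij_betw_def)
      \<comment> \<open>The matching forces \<open>i = j\<close>, which by injectivity of
        \<open>v\<close> means \<open>v i = v j\<close>. The labels can then be eliminated, leaving
        the arcs of a Cartesian product.\<close>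
      have "parcs ?H' = {(xs @ [v i], ys @ [v j]) | xs ys i j.
          xs \<in> pverts ?H \<and> ys \<in> pverts ?H \<and> i \<in> {1..n} \<and> j \<in> {1..n} \<and>
          (xs = ys \<and> (v i, v j) \<in> parcs G \<or> (xs, ys) \<in> parcs ?H \<and> v i = v j)}"
        unfolding self_similar.simps(3) Let_def J pair_pre_digraph.simps
        by (intro Collect_cong ex_cong1) (auto simp: inj_on_eq_iff[OF inj] simp del: self_similar.simps)
      also have "\<dots> = {(xs @ [x], ys @ [y]) | xs ys x y.
          xs \<in> pverts ?H \<and> ys \<in> pverts ?H \<and> x \<in> pverts G \<and> y \<in> pverts G \<and>
          (xs = ys \<and> (x, y) \<in> parcs G \<or> (xs, ys) \<in> parcs ?H \<and> x = y)}"
        unfolding im by blast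
      also have "\<dots> = map_prod ?f ?f ` (?F \<inter> (pverts ?H \<times> pverts G) \<times> pverts ?H \<times> pverts G)"
        by (auto simp: image_iff Bex_def map_prod_def simp del: self_similar.simps)
      finally show ?thesis ..
    qed
    ultimately show ?case by (simp only:)
  qed
qed

lemma conductance_ge:
  assumes "finite (verts H)" "card (verts H) \<ge> 2"
    and "\<And>S. S \<subseteq> verts H \<Longrightarrow> S \<noteq> {} \<Longrightarrow> 2 * card S \<le> card (verts H) \<Longrightarrow>
      c * real (card S) \<le> real (card (edge_boundary H S))"
  shows "conductance H \<ge> c"
proof -
  let ?X = "{S. S \<subseteq> verts H \<and> S \<noteq> {} \<and> real (card S) \<le> real (card (verts H)) / 2}"
  let ?r = "\<lambda>S. real (card (edge_boundary H S)) / real (card S)"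
  have "finite ?X" using assms(1) by simp
  \<comment> \<open>With at least two vertices a singleton is admissible, so the minimum is not
    taken over the empty set, where \<open>Min\<close> would be unspecified.\<close>
  moreover obtain x where "x \<in> verts H" using assms(2) by fastforce
  then have "{x} \<in> ?X" using assms(2) by simp
  moreover have "c \<le> ?r S" if "S \<in> ?X" for S
  proof -
    have "card S > 0"
      using that assms(1) by (auto simp: card_gt_0_iff dest: finite_subset)
    then show ?thesis
      using assms(3)[of S] that by (simp add: pos_le_divide_eq)
  qed
  ultimately have "c \<le> Min (?r ` ?X)"
    by (intro Min.boundedI) auto
  then show ?thesis
    by (simp add: conductance_def setcompr_eq_image)
qed

theorem theorem5p1:
  fixes n k :: nat and v :: "nat \<Rightarrow> 'a" and G :: "'a pair_pre_digraph"
  assumes "n \<ge> 2"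
    and "K\<^bsub>n\<^esub> (with_proj G)"
    and "bij_betw v {1..n} (pverts G)"
    and "k \<ge> 1"
  shows "conductance (with_proj (self_similar n v G (identity_matching n) k)) \<ge> real n / 2"
proof -
  obtain m where k: "k = Suc m"
    using assms(4) by (cases k) auto
  define H where "H = self_similar n v G (identity_matching n) k"
  have fin: "finite (pverts G)" and card: "card (pverts G) = n"
    using assms(3) bij_betw_finite bij_betw_same_card by fastforce+
  have verts: "pverts H = {xs. set xs \<subseteq> pverts G \<and> length xs = k}"
    unfolding H_def using assms(4) by (rule pverts_self_similar)
  have finH: "finite (pverts H)" and cardH: "card (pverts H) = n * n ^ m"
    unfolding verts k using fin card
    by (simp_all add: finite_lists_length_eq card_lists_length_eq)
  have bound: "cut_bound (pverts H) (parcs H) (n ^ m)"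
    unfolding H_def k using assms(2,3) by (rule cut_bound_self_similar)
  have "conductance (with_proj H) \<ge> real n / 2"
  proof (rule conductance_ge)
    show "finite (verts (with_proj H))" using finH by simp
    have "2 * 1 \<le> n * n ^ m" using assms(1) by (intro mult_le_mono) auto
    then show "card (verts (with_proj H)) \<ge> 2" using cardH by simp
  next
    fix S assume S: "S \<subseteq> verts (with_proj H)" "2 * card S \<le> card (verts (with_proj H))"
    let ?b = "card (parcs H \<inter> S \<times> (pverts H - S))"
    have "card (pverts H - S) = n * n ^ m - card S"
      using S finH cardH by (simp add: card_Diff_subset finite_subset)
    \<comment> \<open>The size restriction on \<open>S\<close> enters here: the complement has at
      least half of the vertices, so \<open>card (pverts H - S)\<close> can be traded for
      \<open>n * n ^ m\<close> at the cost of a factor 2.\<close>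
    then have "n * n ^ m \<le> 2 * card (pverts H - S)"
      using S(2) cardH by simp
    then have "card S * (n * n ^ m) \<le> 2 * (card S * card (pverts H - S))"
      by (metis mult.left_commute mult_le_mono2)
    also have "\<dots> \<le> 2 * (n ^ m * ?b)"
      using cut_boundD[OF bound] S(1) by simp
    finally have "n ^ m * (n * card S) \<le> n ^ m * (2 * ?b)"
      by (simp add: ac_simps)
    then have "n * card S \<le> 2 * ?b"
      using assms(1) by simp
    then have "real n * real (card S) \<le> 2 * real ?b"
      by (metis of_nat_le_iff of_nat_mult of_nat_numeral)
    \<comment> \<open>The arcs of \<open>with_proj H\<close> are the pairs themselves, with the
      projections as tail and head.\<close>
    moreover have "edge_boundary (with_proj H) S = parcs H \<inter> S \<times> (pverts H - S)"
      by (auto simp: edge_boundary_def)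
    ultimately show "real n / 2 * real (card S) \<le> real (card (edge_boundary (with_proj H) S))"
      by simp
  qed
  then show ?thesis by (simp add: H_def)
qed

end
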